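(* Let $c_9(n)$ be defined by $\frac{1}{\Psi(-q^9,q)} = \sum_{n=0}^\infty c_9(n) q^n$. It holds that $$\sum_{n=0}^\infty c_9(8n+4) q^n \equiv_2 \Psi(-q^{14},-q^6).$$ As a result, $c_9(8n+4)$ possesses many even progressions of the form $c_9(An+B) \equiv 0 \pmod{2}$ for all $n$, including $$(A,B) \in \{ (16,12), (24,12), (56,20), (56,28), (56,44), \dots \}.$$ More generally, $c_9(8n+4) \equiv 0 \pmod{2}$ if $n$ cannot be represented in the form $n = 10k^2 - 4k$ for integer $k$.
   Context: The false theta function is the formal power series in $q$ (for $a,b$ equal to signed powers of $q$) given by $$\Psi(a,b) := \sum_{n=0}^\infty a^{\binom{n+1}{2}} b^{\binom{n}{2}} - \sum_{n=-\infty}^{-1} a^{\binom{n+1}{2}} b^{\binom{n}{2}},$$ where for every integer $n$, $\binom{n+1}{2} = n(n+1)/2$ and $\binom{n}{2} = n(n-1)/2$. The series $\Psi(-q^9,q)$ has constant term $1$, so its reciprocal is a power series with integer coefficients. For power series $f(q)=\sum a(n)q^n$ and $g(q)=\sum b(n)q^n$ with integer coefficients, $f(q) \equiv_m g(q)$ means $a(n) \equiv b(n) \pmod m$ for all $n$. The index $n$ in the statements about $c_9$ ranges over nonnegative integers; the ellipsis in the list of pairs $(A,B)$ indicates that the list of such progressions inside the residue class $4$ modulo $8$ is not exhaustive. *)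

theory Defs
  imports "HOL-Analysis.Infinite_Sum" "HOL-Number_Theory.Cong"
begin

unbundle fps_syntax

text \<open>
  The sums range over sets of integers and are taken in the \<open>q\<close>-adic topology of the formal power
  series; \<open>fps_X\<close> plays the role of \<open>q\<close>. Both exponents are nonnegative for every integer \<open>n\<close> and
  both divisions are exact, so nothing is lost by \<open>nat\<close> and \<open>div\<close>.
\<close>

definition false_theta_term :: "int fps \<Rightarrow> int fps \<Rightarrow> int \<Rightarrow> int fps" where
  "false_theta_term a b n = a ^ nat (n * (n + 1) div 2) * b ^ nat (n * (n - 1) div 2)"

definition false_theta :: "int fps \<Rightarrow> int fps \<Rightarrow> int fps" where
  "false_theta a b =
     (\<Sum>\<^sub>\<infinity>n\<in>{0..}. false_theta_term a b n) - (\<Sum>\<^sub>\<infinity>n\<in>{..-1}. false_theta_term a b n)"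

text \<open>
  The class-based \<open>inverse\<close> on power series needs an \<open>inverse\<close> on the coefficients, which type \<open>int\<close>
  does not have. The second argument of \<open>fps_left_inverse\<close> is the inverse of the constant term,
  which is 1 here; the lemma \<open>c9_reciprocal\<close> below confirms that this is the reciprocal.
\<close>

definition c9 :: "nat \<Rightarrow> int" where
  "c9 n = fps_left_inverse (false_theta (- (fps_X ^ 9)) fps_X) 1 $ n"

definition fps_cong :: "int \<Rightarrow> int fps \<Rightarrow> int fps \<Rightarrow> bool" where
  "fps_cong m f g \<longleftrightarrow> (\<forall>n. [f $ n = g $ n] (mod m))"

lemma false_theta_exponents:
  fixes n :: int
  shows "nat (n * (n + 1) div 2) + nat (n * (n - 1) div 2) = nat (n ^ 2)"
proof -
  have "n * (n + 1) \<ge> 0" "n * (n - 1) \<ge> 0"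
    by (auto simp: zero_le_mult_iff)
  moreover have "n * (n + 1) div 2 + n * (n - 1) div 2 = (n * (n + 1) + n * (n - 1)) div 2"
    by (subst div_plus_div_distrib_dvd_left) auto
  moreover have "(n * (n + 1) + n * (n - 1)) div 2 = n ^ 2"
    by (simp add: algebra_simps power2_eq_square)
  ultimately show ?thesis
    by (simp add: nat_add_distrib [symmetric])
qed

lemma false_theta_term_signed_powers:
  "false_theta_term (fps_const s * fps_X ^ i) (fps_const t * fps_X ^ j) n =
     fps_const (s ^ nat (n * (n + 1) div 2) * t ^ nat (n * (n - 1) div 2)) *
     fps_X ^ (i * nat (n * (n + 1) div 2) + j * nat (n * (n - 1) div 2))"
  by (simp add: false_theta_term_def power_mult_distrib power_mult power_add mult_ac
        flip: fps_const_mult)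

lemma false_theta_term_nth_neq_0:
  assumes "false_theta_term (fps_const s * fps_X ^ i) (fps_const t * fps_X ^ j) n $ m \<noteq> 0"
    and "i > 0" "j > 0"
  shows "\<bar>n\<bar> \<le> int m"
proof -
  let ?e = "nat (n * (n + 1) div 2)" and ?f = "nat (n * (n - 1) div 2)"
  have m: "m = i * ?e + j * ?f"
    using assms(1) by (simp add: false_theta_term_signed_powers split: if_splits)
  have "?e \<le> i * ?e" "?f \<le> j * ?f"
    using assms by auto
  hence "nat (n ^ 2) \<le> m"
    using m false_theta_exponents[of n] by linarith
  moreover have "\<bar>n\<bar> \<le> n ^ 2"
    using mult_left_mono[of 1 "\<bar>n\<bar>" "\<bar>n\<bar>"] by (cases "n = 0") (auto simp: power2_eq_square)
  ultimately show ?thesis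
    by linarith
qed

lemma has_sum_false_theta_term:
  fixes s t :: int
  assumes "i > 0" "j > 0"
  defines "F \<equiv> false_theta_term (fps_const s * fps_X ^ i) (fps_const t * fps_X ^ j)"
  shows "(F has_sum Abs_fps (\<lambda>m. \<Sum>n | n \<in> A \<and> F n $ m \<noteq> 0. F n $ m)) A"
proof (rule has_sum_fpsI)
  fix m
  have "{n \<in> A. F n $ m \<noteq> 0} \<subseteq> {- int m..int m}"
    using false_theta_term_nth_neq_0[OF _ assms(1,2)] unfolding F_def by fastforce
  thus "finite {n \<in> A. F n $ m \<noteq> 0}"
    by (rule finite_subset) auto
qed simp

lemma c9_reciprocal: "Abs_fps c9 * false_theta (- (fps_X ^ 9)) fps_X = 1"
proof -
  define F where "F = false_theta_term (fps_const (-1) * fps_X ^ 9) (fps_const 1 * fps_X ^ 1)"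
  have F: "false_theta_term (- (fps_X ^ 9)) fps_X = F"
  proof -
    have "fps_const (-1 :: int) = -1"
      by (metis fps_const_1_eq_1 fps_const_neg)
    thus ?thesis
      by (simp add: F_def)
  qed
  have nz: "n = 0" if "F n $ 0 \<noteq> 0" for n
    using false_theta_term_nth_neq_0[of "-1" 9 1 1 n 0] that unfolding F_def by simp
  have "F 0 $ 0 = 1"
    by (simp add: F_def false_theta_term_def)
  hence "{n \<in> {0..}. F n $ 0 \<noteq> 0} = {0}" "{n \<in> {..-1}. F n $ 0 \<noteq> 0} = {}"
    using nz by fastforce+
  moreover have "infsum F A $ 0 = (\<Sum>n | n \<in> A \<and> F n $ 0 \<noteq> 0. F n $ 0)" for A
    using infsumI[OF has_sum_false_theta_term[of 9 1 "-1" 1 A, folded F_def]] by simp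
  ultimately have "false_theta (- (fps_X ^ 9)) fps_X $ 0 = 1"
    using \<open>F 0 $ 0 = 1\<close> by (simp add: false_theta_def F)
  moreover have "Abs_fps c9 = fps_left_inverse (false_theta (- (fps_X ^ 9)) fps_X) 1"
    by (simp add: fps_eq_iff c9_def)
  ultimately show ?thesis
    by (simp add: fps_left_inverse)
qed

end

theory Submission
  imports Defs "HOL-Library.Z2"
begin

text \<open>
  Modulo 2 the signs in \<open>\<Psi>\<close> disappear, so \<open>\<Psi>(-q\<^sup>9, q)\<close> becomes
  \<open>F(q) = \<Sum>q\<^bsup>5n\<^sup>2 + 4n\<^esup>\<close>, summed over all integers \<open>n\<close>. As \<open>F(q)\<^sup>2 \<equiv> F(q\<^sup>2)\<close>, the reciprocal \<open>C\<close>
  of \<open>F\<close> satisfies \<open>C(q) F(q\<^sup>8) \<equiv> F(q)\<^sup>7 \<equiv> F(q) F(q\<^sup>2) F(q\<^sup>4)\<close>. The coefficient of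
  \<open>q\<^bsup>8M + 4\<^esup>\<close> on the right counts the representations
  \<open>5(8M + 4) + 28 = u\<^sup>2 + 2v\<^sup>2 + 4w\<^sup>2\<close> with \<open>u\<close>, \<open>v\<close>, \<open>w\<close> congruent to 2 modulo 5. Here \<open>u\<close> and \<open>v\<close>
  must be even and \<open>u/2 \<equiv> w\<close> modulo 2; with \<open>p = (w + u/2)/2\<close> and \<open>r = (u/2 - w)/2\<close> the equation
  becomes \<open>5M + 6 = p\<^sup>2 + (v/2)\<^sup>2 + r\<^sup>2\<close>, where \<open>-p\<close> and \<open>v/2\<close> are congruent to 1 modulo 5. Swapping
  these two leaves, modulo 2, only the solutions with \<open>-p = v/2\<close>, which are counted by the
  coefficient of \<open>q\<^sup>M\<close> in \<open>F(q) \<Sum>q\<^bsup>10k\<^sup>2 + 4k\<^esup>\<close>. Finally \<open>F\<close> is cancelled.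
\<close>

section \<open>Congruences of power series\<close>

lemma fps_cong_refl [simp]: "fps_cong m f f"
  by (simp add: fps_cong_def)

lemma fps_cong_sym: "fps_cong m f g \<Longrightarrow> fps_cong m g f"
  by (simp add: fps_cong_def cong_sym_eq)

lemma fps_cong_trans [trans]: "fps_cong m f g \<Longrightarrow> fps_cong m g h \<Longrightarrow> fps_cong m f h"
  unfolding fps_cong_def by (blast intro: cong_trans)

lemma fps_cong_mult: "fps_cong m f g \<Longrightarrow> fps_cong m f' g' \<Longrightarrow> fps_cong m (f * f') (g * g')"
  unfolding fps_cong_def fps_mult_nth by (intro allI cong_sum cong_mult) auto

lemma fps_cong_power: "fps_cong m f g \<Longrightarrow> fps_cong m (f ^ n) (g ^ n)"
  by (induction n) (auto intro: fps_cong_mult)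

section \<open>Counting series\<close>

text \<open>This is the generating function \<Sum>q^(e x). Since \<open>card\<close> sends an
  infinite fibre to 0, the lemmas on products assume finite fibres.\<close>

definition counting_fps :: "('a \<Rightarrow> nat) \<Rightarrow> int fps" where
  "counting_fps e = Abs_fps (\<lambda>m. int (card {x. e x = m}))"

lemma counting_fps_nth: "counting_fps e $ m = int (card {x. e x = m})"
  by (simp add: counting_fps_def)

lemma counting_fps_mult:
  assumes "\<And>m. finite {x. e x = m}" "\<And>m. finite {y. e' y = m}"
  shows "counting_fps e * counting_fps e' = counting_fps (\<lambda>(x, y). e x + e' y)"
proof (rule fps_ext)
  fix m
  have "{z. (case z of (x, y) \<Rightarrow> e x + e' y) = m} =
          (\<Union>i\<in>{0..m}. {x. e x = i} \<times> {y. e' y = m - i})"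
    by auto
  moreover have "card \<dots> = (\<Sum>i\<in>{0..m}. card ({x. e x = i} \<times> {y. e' y = m - i}))"
    using assms by (intro card_UN_disjoint) auto
  ultimately show "(counting_fps e * counting_fps e') $ m = counting_fps (\<lambda>(x, y). e x + e' y) $ m"
    by (simp add: fps_mult_nth counting_fps_nth card_cartesian_product)
qed

text \<open>The points that the involution \<open>h\<close> moves fall into pairs.\<close>

lemma cong_card_fixed_points:
  assumes "finite X"
    and "\<And>x. x \<in> X \<Longrightarrow> h x \<in> X" "\<And>x. x \<in> X \<Longrightarrow> h (h x) = x"
  shows "[int (card X) = int (card {x \<in> X. h x = x})] (mod 2)"
proof -
  let ?Y = "{x \<in> X. h x \<noteq> x}"
  \<comment> \<open>In the two-element field \<open>bit\<close>, the terms of \<open>x\<close> and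
    \<open>h x\<close> cancel because 1 + 1 = 0.\<close>
  have "(\<Sum>x\<in>?Y. 1 :: bit) = 0"
    by (rule sum_involution_eq_0[where h = h]) (use assms in auto)
  hence "(of_nat (card ?Y) :: bit) = 0"
    by simp
  hence "even (card ?Y)"
    by (metis dvd_0_right even_of_nat)
  moreover have "card X = card {x \<in> X. h x = x} + card ?Y"
    using assms(1) by (subst card_Un_disjoint[symmetric]) (auto intro!: arg_cong[where f = card])
  ultimately show ?thesis
    by (auto simp: cong_iff_dvd_diff)
qed

text \<open>Swapping the entries of the pairs counted by the square fixes exactly the diagonal; this
  is f(q)^2 \<equiv> f(q^2) modulo 2.\<close>

lemma counting_fps_square:
  assumes "\<And>m. finite {x. e x = m}"
  shows "fps_cong 2 (counting_fps e ^ 2) (counting_fps (\<lambda>x. 2 * e x))"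
  unfolding fps_cong_def
proof
  fix m
  let ?X = "{(x, y). e x + e y = m}"
  have "?X \<subseteq> (\<Union>i\<in>{..m}. \<Union>j\<in>{..m}. {x. e x = i} \<times> {y. e y = j})"
    by auto
  hence "finite ?X"
    by (rule finite_subset) (use assms in auto)
  hence "[int (card ?X) = int (card {z \<in> ?X. prod.swap z = z})] (mod 2)"
    by (rule cong_card_fixed_points) auto
  moreover have "prod.swap z = z \<longleftrightarrow> fst z = snd z" for z :: "'a \<times> 'a"
    by (cases z) auto
  hence "bij_betw (\<lambda>x. (x, x)) {x. 2 * e x = m} {z \<in> ?X. prod.swap z = z}"
    by (intro bij_betw_byWitness[where f' = fst]) auto
  ultimately show "[(counting_fps e ^ 2) $ m = counting_fps (\<lambda>x. 2 * e x) $ m] (mod 2)"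
    by (simp add: power2_eq_square counting_fps_mult[OF assms assms] counting_fps_nth
        bij_betw_same_card case_prod_unfold)
qed

text \<open>The second factor is a series in q^d, so only the coefficients of \<open>f\<close> at
  exponents congruent to \<open>r\<close> modulo \<open>d\<close> contribute.\<close>

lemma mult_counting_fps_section:
  assumes "r < d"
  shows "(f * counting_fps (\<lambda>x. d * e x)) $ (d * n + r) =
         (Abs_fps (\<lambda>n. f $ (d * n + r)) * counting_fps e) $ n"
proof -
  have d: "d > 0"
    using assms by simp
  let ?g = "counting_fps (\<lambda>x. d * e x)"
  have g: "?g $ (d * i) = counting_fps e $ i" for i
    using d by (simp add: counting_fps_nth)
  have g0: "?g $ i = 0" if "\<not> d dvd i" for i
  proof -
    have "{x. d * e x = i} = {}"
      using that by auto
    thus ?thesis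
      by (simp add: counting_fps_nth)
  qed
  \<comment> \<open>Here \<open>r < d\<close> matters: the multiples of \<open>d\<close> up to
    \<open>d * n + r\<close> stop at \<open>d * n\<close>.\<close>
  have "i \<le> n" if "d * i \<le> d * n + r" for i
  proof (rule ccontr)
    assume "\<not> i \<le> n"
    hence "d * (n + 1) \<le> d * i"
      by (intro mult_left_mono) auto
    with that assms show False
      by simp
  qed
  hence sub: "{i \<in> {0..d * n + r}. d dvd i} = (*) d ` {0..n}"
    by (auto elim!: dvdE intro: trans_le_add1)
  have "(?g * f) $ (d * n + r) = (\<Sum>i\<in>{0..d * n + r}. ?g $ i * f $ (d * n + r - i))"
    by (simp add: fps_mult_nth)
  also have "\<dots> = (\<Sum>i\<in>{i \<in> {0..d * n + r}. d dvd i}. ?g $ i * f $ (d * n + r - i))"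
    by (rule sum.mono_neutral_right) (auto simp: g0)
  also have "\<dots> = (\<Sum>j\<in>{0..n}. ?g $ (d * j) * f $ (d * n + r - d * j))"
    unfolding sub using d by (subst sum.reindex) (auto simp: inj_on_def)
  also have "\<dots> = (\<Sum>j\<in>{0..n}. counting_fps e $ j * f $ (d * (n - j) + r))"
    by (intro sum.cong refl) (simp add: g right_diff_distrib')
  also have "\<dots> = (counting_fps e * Abs_fps (\<lambda>n. f $ (d * n + r))) $ n"
    by (simp add: fps_mult_nth)
  finally show ?thesis
    by (simp add: mult.commute)
qed

section \<open>False theta functions modulo 2\<close>

text \<open>Odd \<open>s\<close> and \<open>t\<close> give every monomial an odd coefficient, and
  modulo 2 the half over negative \<open>n\<close> may be added instead of subtracted.\<close>

lemma false_theta_cong_counting_fps: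
  assumes "i > 0" "j > 0" "odd s" "odd t"
  shows "fps_cong 2 (false_theta (fps_const s * fps_X ^ i) (fps_const t * fps_X ^ j))
           (counting_fps (\<lambda>n. i * nat (n * (n + 1) div 2) + j * nat (n * (n - 1) div 2)))"
  unfolding fps_cong_def
proof
  fix m
  define F where "F = false_theta_term (fps_const s * fps_X ^ i) (fps_const t * fps_X ^ j)"
  define E where "E n = i * nat (n * (n + 1) div 2) + j * nat (n * (n - 1) div 2)" for n :: int
  have odd_F: "odd (F n $ m)" if "E n = m" for n
    using that assms by (simp add: F_def E_def false_theta_term_signed_powers)
  have nz: "F n $ m \<noteq> 0 \<longleftrightarrow> E n = m" for n
  proof
    show "E n = m" if "F n $ m \<noteq> 0"
      using that by (simp add: F_def E_def false_theta_term_signed_powers split: if_splits)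
  qed (use odd_F in force)
  have "\<bar>n\<bar> \<le> int m" if "E n = m" for n
    using false_theta_term_nth_neq_0[of s i t j n m] that nz[of n] assms by (simp add: F_def)
  hence "{n. E n = m} \<subseteq> {- int m..int m}"
    by (auto simp: abs_le_iff minus_le_iff)
  hence fin: "finite {n. E n = m}"
    by (rule finite_subset) auto
  have *: "[infsum F A $ m = int (card {n \<in> A. E n = m})] (mod 2)" for A
  proof -
    have "infsum F A $ m = (\<Sum>n | n \<in> A \<and> E n = m. F n $ m)"
      using infsumI[OF has_sum_false_theta_term[of i j s t A, folded F_def]] assms
      by (simp add: nz)
    also have "[\<dots> = (\<Sum>n | n \<in> A \<and> E n = m. 1)] (mod 2)"
      using odd_F by (intro cong_sum) (auto simp: cong_def odd_iff_mod_2_eq_one)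
    finally show ?thesis
      by simp
  qed
  have "int (card {n. E n = m}) =
          int (card {n \<in> {0..}. E n = m}) + int (card {n \<in> {..-1}. E n = m})"
    unfolding of_nat_add [symmetric]
    by (subst card_Un_disjoint[symmetric]) (auto intro!: arg_cong[where f = card] intro: finite_subset[OF _ fin])
  moreover have "even (infsum F {0..} $ m - int (card {n \<in> {0..}. E n = m}))"
    "even (infsum F {..-1} $ m - int (card {n \<in> {..-1}. E n = m}))"
    using *[of "{0..}"] *[of "{..-1}"] by (simp_all add: cong_iff_dvd_diff)
  ultimately have "[(infsum F {0..} - infsum F {..-1}) $ m = int (card {n. E n = m})] (mod 2)"
    by (simp add: cong_iff_dvd_diff)
  thus "[false_theta (fps_const s * fps_X ^ i) (fps_const t * fps_X ^ j) $ m =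
          counting_fps (\<lambda>n. i * nat (n * (n + 1) div 2) + j * nat (n * (n - 1) div 2)) $ m] (mod 2)"
    by (simp add: false_theta_def F_def E_def counting_fps_nth)
qed

lemma false_theta_exponent_linear:
  fixes n :: int
  shows "i * nat (n * (n + 1) div 2) + j * nat (n * (n - 1) div 2) =
         nat (((int i + int j) * n ^ 2 + (int i - int j) * n) div 2)"
proof -
  have "n * (n + 1) \<ge> 0" "n * (n - 1) \<ge> 0"
    by (auto simp: zero_le_mult_iff)
  \<comment> \<open>With \<open>k\<close> the triangular number n(n+1)/2, the other exponent
    n(n-1)/2 is \<open>k - n\<close>.\<close>
  moreover obtain k where k: "n * (n + 1) = 2 * k"
    by (metis dvd_def even_mult_iff even_plus_one_iff)
  moreover have k': "n * (n - 1) = 2 * (k - n)"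
    using k by (simp add: algebra_simps)
  moreover have "(int i + int j) * n ^ 2 + (int i - int j) * n = 2 * (int i * k + int j * (k - n))"
  proof -
    have "(int i + int j) * n ^ 2 + (int i - int j) * n = int i * (n * (n + 1)) + int j * (n * (n - 1))"
      by (simp add: algebra_simps power2_eq_square)
    thus ?thesis
      unfolding k k' by (simp add: algebra_simps)
  qed
  ultimately have "int (i * nat (n * (n + 1) div 2) + j * nat (n * (n - 1) div 2)) =
      ((int i + int j) * n ^ 2 + (int i - int j) * n) div 2"
    by simp
  thus ?thesis
    by (metis nat_int)
qed

lemma fps_const_neg_one: "fps_const (-1 :: int) = -1"
  by (metis fps_const_1_eq_1 fps_const_neg)

lemma false_theta_9_1_cong:
  "fps_cong 2 (false_theta (- (fps_X ^ 9)) fps_X) (counting_fps (\<lambda>n::int. nat (5 * n ^ 2 + 4 * n)))"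
proof -
  have "9 * nat (n * (n + 1) div 2) + 1 * nat (n * (n - 1) div 2) = nat (5 * n ^ 2 + 4 * n)" for n :: int
    using false_theta_exponent_linear[of 9 n 1] by simp
  thus ?thesis
    using false_theta_cong_counting_fps[of 9 1 "-1" 1] by (simp add: fps_const_neg_one)
qed

lemma false_theta_14_6_cong:
  "fps_cong 2 (false_theta (- (fps_X ^ 14)) (- (fps_X ^ 6)))
     (counting_fps (\<lambda>n::int. nat (10 * n ^ 2 + 4 * n)))"
proof -
  have "14 * nat (n * (n + 1) div 2) + 6 * nat (n * (n - 1) div 2) = nat (10 * n ^ 2 + 4 * n)" for n :: int
    using false_theta_exponent_linear[of 14 n 6] by simp
  thus ?thesis
    using false_theta_cong_counting_fps[of 14 6 "-1" "-1"] by (simp add: fps_const_neg_one)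
qed

section \<open>The ternary quadratic form\<close>

text \<open>As |n| \<le> n^2, the linear term is absorbed by (a-1) n^2. The bound yields both
  nonnegative exponents and finite fibres.\<close>

lemma linear_le_quadratic:
  fixes n :: int
  assumes "a > \<bar>b\<bar>"
  shows "\<bar>n\<bar> \<le> a * n ^ 2 + b * n"
proof -
  have n2: "\<bar>n\<bar> \<le> n ^ 2"
    using mult_left_mono[of 1 "\<bar>n\<bar>" "\<bar>n\<bar>"] by (cases "n = 0") (auto simp: power2_eq_square)
  have "- (b * n) \<le> \<bar>b\<bar> * \<bar>n\<bar>"
    by (metis abs_ge_minus_self abs_mult)
  also have "\<dots> \<le> (a - 1) * n ^ 2"
    using assms n2 by (intro mult_mono) auto
  finally show ?thesis
    using n2 by (simp add: algebra_simps)
qed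

lemma finite_quadratic_fibre:
  assumes "a > \<bar>b\<bar>"
  shows "finite {n::int. nat (a * n ^ 2 + b * n) = m}"
proof (rule finite_subset)
  show "{n. nat (a * n ^ 2 + b * n) = m} \<subseteq> {- int m..int m}"
    using linear_le_quadratic[OF assms] by (smt (verit) atLeastAtMost_iff mem_Collect_eq nat_0_le subsetI)
qed simp

text \<open>Completing squares with u = 5a + 2, v = 5b + 2, w = 5c + 2, the new variables are given
  by -p = 5x + 1, v/2 = 5j + 1 and r = 5y + 2.\<close>

lemma ternary_parametrisation:
  fixes M :: int
  shows "bij_betw (\<lambda>(x, j, y). (2 * (y - x), 2 * j, - (x + y) - 1))
    {(x, j, y). (5 * x ^ 2 + 2 * x) + (5 * j ^ 2 + 2 * j) + (5 * y ^ 2 + 4 * y) = M}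
    {(a, b, c). (5 * a ^ 2 + 4 * a) + 2 * (5 * b ^ 2 + 4 * b) + 4 * (5 * c ^ 2 + 4 * c) = 8 * M + 4}"
proof (rule bij_betw_imageI)
  show "inj_on (\<lambda>(x, j, y). (2 * (y - x), 2 * j, - (x + y) - 1))
    {(x, j, y). (5 * x ^ 2 + 2 * x) + (5 * j ^ 2 + 2 * j) + (5 * y ^ 2 + 4 * y) = M}"
    by (auto simp: inj_on_def)
next
  have eq: "(5 * (2 * (y - x)) ^ 2 + 4 * (2 * (y - x))) + 2 * (5 * (2 * j) ^ 2 + 4 * (2 * j)) +
      4 * (5 * (- (x + y) - 1) ^ 2 + 4 * (- (x + y) - 1)) =
      8 * ((5 * x ^ 2 + 2 * x) + (5 * j ^ 2 + 2 * j) + (5 * y ^ 2 + 4 * y)) + 4" for x j y :: int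
    by (simp add: algebra_simps power2_eq_square)
  have surj: "\<exists>x j y. a = 2 * (y - x) \<and> b = 2 * j \<and> c = - (x + y) - 1"
    if *: "(5 * a ^ 2 + 4 * a) + 2 * (5 * b ^ 2 + 4 * b) + 4 * (5 * c ^ 2 + 4 * c) = 8 * M + 4" for a b c
  proof -
    \<comment> \<open>Reading the equation modulo 2, then halving and repeating, shows successively
      that \<open>a\<close> is even, \<open>b\<close> is even, and a/2 and \<open>c\<close> have
      opposite parity.\<close>
    have "5 * a ^ 2 = 2 * (4 * M + 2 - 2 * a - (5 * b ^ 2 + 4 * b) - 2 * (5 * c ^ 2 + 4 * c))"
      using * by (simp add: algebra_simps)
    hence "even (5 * a ^ 2)"
      by (metis dvd_triv_left)
    then obtain i where i: "a = 2 * i"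
      by auto
    have "5 * b ^ 2 = 2 * (2 * M + 1 - 5 * i ^ 2 - 2 * i - 2 * b - (5 * c ^ 2 + 4 * c))"
      using * by (simp add: algebra_simps i power2_eq_square)
    hence "even (5 * b ^ 2)"
      by (metis dvd_triv_left)
    then obtain j where j: "b = 2 * j"
      by auto
    have ic: "5 * (i ^ 2 + c ^ 2) = 2 * (M - i - 5 * j ^ 2 - 2 * j - 2 * c) + 1"
      using * by (simp add: algebra_simps i j power2_eq_square)
    have "odd (5 * (i ^ 2 + c ^ 2))"
      unfolding ic by simp
    hence "even (i - c - 1)"
      by auto
    then obtain y where "i - c - 1 = 2 * y"
      by (rule evenE)
    hence "a = 2 * (y - (y - i)) \<and> b = 2 * j \<and> c = - ((y - i) + y) - 1"
      using i j by auto
    thus ?thesis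
      by blast
  qed
  show "(\<lambda>(x, j, y). (2 * (y - x), 2 * j, - (x + y) - 1)) `
    {(x, j, y). (5 * x ^ 2 + 2 * x) + (5 * j ^ 2 + 2 * j) + (5 * y ^ 2 + 4 * y) = M} =
    {(a, b, c). (5 * a ^ 2 + 4 * a) + 2 * (5 * b ^ 2 + 4 * b) + 4 * (5 * c ^ 2 + 4 * c) = 8 * M + 4}"
    (is "?f ` ?A = ?B")
  proof (intro subset_antisym subsetI)
    fix z assume "z \<in> ?f ` ?A"
    then obtain x j y where "(x, j, y) \<in> ?A" "z = ?f (x, j, y)"
      by fast
    thus "z \<in> ?B"
      using eq[of y x j] by simp
  next
    fix z assume z: "z \<in> ?B"
    obtain a b c where abc: "z = (a, b, c)"
      by (cases z)
    with z obtain x j y where xjy: "a = 2 * (y - x)" "b = 2 * j" "c = - (x + y) - 1"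
      using surj[of a b c] by auto
    have "(x, j, y) \<in> ?A"
      using z eq[of y x j] unfolding abc xjy by simp
    moreover have "z = ?f (x, j, y)"
      by (simp add: abc xjy)
    ultimately show "z \<in> ?f ` ?A"
      by blast
  qed
qed

text \<open>The variables \<open>x\<close> and \<open>j\<close> enter through the same polynomial,
  so \<open>h\<close> may swap them; on its fixed points 2(5x^2 + 2x) = 10x^2 + 4x.\<close>

lemma ternary_count_cong:
  "[int (card {(a, b, c). nat (5 * a ^ 2 + 4 * a) + 2 * nat (5 * b ^ 2 + 4 * b) +
       4 * nat (5 * c ^ 2 + 4 * c) = 8 * M + 4}) =
    int (card {(x, y). nat (10 * x ^ 2 + 4 * x) + nat (5 * y ^ 2 + 4 * y) = M})] (mod 2)"
  (is "[int (card ?T) = int (card ?P)] (mod 2)")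
proof -
  let ?X = "{(x, j, y). (5 * x ^ 2 + 2 * x) + (5 * j ^ 2 + 2 * j) + (5 * y ^ 2 + 4 * y) = int M}"
  define h :: "int \<times> int \<times> int \<Rightarrow> int \<times> int \<times> int" where "h = (\<lambda>(x, j, y). (j, x, y))"
  note le = linear_le_quadratic[of 2 5] linear_le_quadratic[of 4 5] linear_le_quadratic[of 4 10]
  \<comment> \<open>Nonnegativity lets the equations between \<open>nat\<close> values be read over
    the integers.\<close>
  have ge0: "5 * n ^ 2 + 4 * n \<ge> 0" "10 * n ^ 2 + 4 * n \<ge> 0" for n :: int
    using le(2,3)[of n] by simp_all
  have "?T = {(a, b, c). (5 * a ^ 2 + 4 * a) + 2 * (5 * b ^ 2 + 4 * b) + 4 * (5 * c ^ 2 + 4 * c) =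
      8 * int M + 4}"
    using ge0 by (auto simp: nat_eq_iff2 simp flip: of_nat_eq_iff[where 'a = int])
  hence "card ?T = card ?X"
    using bij_betw_same_card[OF ternary_parametrisation[of "int M"]] by simp
  moreover have "finite ?X"
  proof (rule finite_subset)
    show "?X \<subseteq> {- int M..int M} \<times> {- int M..int M} \<times> {- int M..int M}"
    proof clarsimp
      fix x j y :: int
      assume "(5 * x ^ 2 + 2 * x) + (5 * j ^ 2 + 2 * j) + (5 * y ^ 2 + 4 * y) = int M"
      thus "- int M \<le> x \<and> x \<le> int M \<and> - int M \<le> j \<and> j \<le> int M \<and> - int M \<le> y \<and> y \<le> int M"
        using le(1)[of x] le(1)[of j] le(2)[of y] by auto
    qed
  qed auto
  hence "[int (card ?X) = int (card {z \<in> ?X. h z = z})] (mod 2)"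
    by (rule cong_card_fixed_points) (auto simp: h_def)
  moreover have "bij_betw (\<lambda>(x, y). (x, x, y)) ?P {z \<in> ?X. h z = z}"
  proof -
    have "nat (10 * x ^ 2 + 4 * x) + nat (5 * y ^ 2 + 4 * y) = M \<longleftrightarrow>
        (5 * x ^ 2 + 2 * x) + (5 * x ^ 2 + 2 * x) + (5 * y ^ 2 + 4 * y) = int M" for x y :: int
      using ge0[of x] ge0[of y] by auto
    thus ?thesis
      by (auto simp: bij_betw_def inj_on_def h_def)
  qed
  ultimately show ?thesis
    by (simp add: bij_betw_same_card)
qed

section \<open>The progression \<open>8n + 4\<close>\<close>

lemma c9_section_cong:
  "fps_cong 2 (Abs_fps (\<lambda>n. c9 (8 * n + 4))) (counting_fps (\<lambda>n::int. nat (10 * n ^ 2 + 4 * n)))"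
proof -
  define e where "e n = nat (5 * n ^ 2 + 4 * n)" for n :: int
  define g where "g n = nat (10 * n ^ 2 + 4 * n)" for n :: int
  define C where "C = Abs_fps c9"
  define S where "S = Abs_fps (\<lambda>n. c9 (8 * n + 4))"
  \<comment> \<open>\<open>?F k\<close> stands for F(q^k).\<close>
  let ?F = "\<lambda>k. counting_fps (\<lambda>n. k * e n)"
  have fin_e: "finite {n. e n = m}" and fin_g: "finite {n. g n = m}" for m
    using finite_quadratic_fibre[of 4 5 m] finite_quadratic_fibre[of 4 10 m] by (simp_all add: e_def g_def)
  have fin: "finite {n. k * e n = m}" if "k > 0" for k m
    by (rule finite_subset[OF _ fin_e[of "m div k"]]) (use that in auto)
  have "fps_cong 2 (C * false_theta (- (fps_X ^ 9)) fps_X) (C * ?F 1)"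
    using false_theta_9_1_cong by (intro fps_cong_mult) (simp_all add: e_def)
  hence CF: "fps_cong 2 (C * ?F 1) 1"
    by (simp add: C_def c9_reciprocal fps_cong_sym)
  have sq: "fps_cong 2 (?F k ^ 2) (?F (2 * k))" if "k > 0" for k
    using counting_fps_square[OF fin[OF that]] by (simp add: mult.assoc)
  have F2: "fps_cong 2 (?F 1 ^ 2) (?F 2)"
    using sq[of 1] by simp
  have F4: "fps_cong 2 (?F 1 ^ 4) (?F 4)"
    using fps_cong_trans[OF fps_cong_power[OF F2, of 2] sq[of 2, simplified]]
    by (simp flip: power_mult)
  have F8: "fps_cong 2 (?F 1 ^ 8) (?F 8)"
    using fps_cong_trans[OF fps_cong_power[OF F4, of 2] sq[of 4, simplified]]
    by (simp flip: power_mult)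
  have "fps_cong 2 (C * ?F 8) (C * ?F 1 ^ 8)"
    by (intro fps_cong_mult fps_cong_sym[OF F8]) simp
  also have "C * ?F 1 ^ 8 = (C * ?F 1) * (?F 1 * (?F 1 ^ 2 * ?F 1 ^ 4))"
    by (simp add: power_numeral_reduce mult_ac)
  also have "fps_cong 2 \<dots> (1 * (?F 1 * (?F 2 * ?F 4)))"
    by (intro fps_cong_mult CF F2 F4) simp
  finally have main: "fps_cong 2 (C * ?F 8) (?F 1 * (?F 2 * ?F 4))"
    by simp
  have fin2: "finite {z. (case z of (b, c) \<Rightarrow> 2 * e b + 4 * e c) = m}" for m
  proof (rule finite_subset)
    show "{z. (case z of (b, c) \<Rightarrow> 2 * e b + 4 * e c) = m} \<subseteq>
        (\<Union>i\<in>{..m}. {b. e b = i}) \<times> (\<Union>i\<in>{..m}. {c. e c = i})"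
      by auto
  qed (use fin_e in auto)
  have triple: "?F 1 * (?F 2 * ?F 4) = counting_fps (\<lambda>(a, b, c). e a + 2 * e b + 4 * e c)"
    using fin_e fin[of 2] fin[of 4] fin2
    by (simp add: counting_fps_mult case_prod_unfold add.assoc)
  have "fps_cong 2 (S * ?F 1) (counting_fps g * ?F 1)"
    unfolding fps_cong_def
  proof
    \<comment> \<open>Extracting the exponents 8M + 4 turns F(q^8) into F(q) and \<open>C\<close>
      into \<open>S\<close>.\<close>
    fix M
    have "(S * ?F 1) $ M = (C * ?F 8) $ (8 * M + 4)"
      by (simp add: mult_counting_fps_section S_def C_def)
    also have "[\<dots> = (?F 1 * (?F 2 * ?F 4)) $ (8 * M + 4)] (mod 2)"
      using main by (simp add: fps_cong_def)
    also have "[(?F 1 * (?F 2 * ?F 4)) $ (8 * M + 4) = int (card {(x, y). g x + e y = M})] (mod 2)"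
      using ternary_count_cong[of M]
      by (simp add: triple[simplified] counting_fps_nth e_def [symmetric] g_def [symmetric] case_prod_unfold)
    also have "int (card {(x, y). g x + e y = M}) = (counting_fps g * ?F 1) $ M"
      using fin_e fin_g by (simp add: counting_fps_mult counting_fps_nth case_prod_unfold)
    finally show "[(S * ?F 1) $ M = (counting_fps g * ?F 1) $ M] (mod 2)" .
  qed
  \<comment> \<open>The factor F is cancelled by multiplying with \<open>C\<close>, its inverse
    modulo 2.\<close>
  hence "fps_cong 2 (C * (S * ?F 1)) (C * (counting_fps g * ?F 1))"
    by (rule fps_cong_mult[OF fps_cong_refl])
  hence *: "fps_cong 2 (S * (C * ?F 1)) (counting_fps g * (C * ?F 1))"
    by (simp only: mult_ac)
  have "fps_cong 2 S (S * (C * ?F 1))"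
    using fps_cong_mult[OF fps_cong_refl fps_cong_sym[OF CF], of S] by simp
  also note *
  also have "fps_cong 2 (counting_fps g * (C * ?F 1)) (counting_fps g)"
    using fps_cong_mult[OF fps_cong_refl CF, of "counting_fps g"] by simp
  finally show ?thesis
    by (simp add: S_def g_def [abs_def])
qed

section \<open>Even values and even progressions\<close>

lemma c9_even:
  assumes "\<nexists>k::int. int n = 10 * k ^ 2 - 4 * k"
  shows "[c9 (8 * n + 4) = 0] (mod 2)"
proof -
  have "nat (10 * k ^ 2 + 4 * k) \<noteq> n" for k :: int
  proof
    assume "nat (10 * k ^ 2 + 4 * k) = n"
    \<comment> \<open>The substitution of -k for k reconciles the two signs of the linear
      term.\<close>
    hence "int n = 10 * (- k) ^ 2 - 4 * (- k)"
      using linear_le_quadratic[of 4 10 k] by auto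
    with assms show False
      by blast
  qed
  hence "counting_fps (\<lambda>k::int. nat (10 * k ^ 2 + 4 * k)) $ n = 0"
    by (simp add: counting_fps_nth)
  moreover have "[c9 (8 * n + 4) = counting_fps (\<lambda>k::int. nat (10 * k ^ 2 + 4 * k)) $ n] (mod 2)"
    using c9_section_cong by (simp add: fps_cong_def)
  ultimately show ?thesis
    by simp
qed

lemma quadratic_mod:
  fixes k m :: int
  shows "(10 * k ^ 2 - 4 * k) mod m = (10 * (k mod m) ^ 2 - 4 * (k mod m)) mod m"
  unfolding cong_def [symmetric] by (intro cong_diff cong_mult cong_pow cong_refl) (simp_all add: cong_def)

text \<open>A residue class modulo \<open>m\<close> missed by 10k^2 - 4k contains no represented
  number, and finitely many \<open>r\<close> decide this.\<close>

lemma c9_even_progression: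
  assumes "m > 0" "\<forall>r\<in>{0..<int m}. (10 * r ^ 2 - 4 * r) mod int m \<noteq> int b mod int m"
  shows "[c9 (8 * (m * n + b) + 4) = 0] (mod 2)"
proof (rule c9_even, rule notI, elim exE)
  fix k assume "int (m * n + b) = 10 * k ^ 2 - 4 * k"
  hence "int b mod int m = (10 * k ^ 2 - 4 * k) mod int m"
    by (metis mod_mult_self4 of_nat_add of_nat_mult)
  thus False
    using assms quadratic_mod[of k "int m"] by auto
qed

theorem theorem3:
  shows "fps_cong 2 (Abs_fps (\<lambda>n. c9 (8 * n + 4))) (false_theta (- (fps_X ^ 14)) (- (fps_X ^ 6)))
    \<and> (\<forall>(A, B) \<in> {(16, 12), (24, 12), (56, 20), (56, 28), (56, 44)}.
          \<forall>n::nat. [c9 (A * n + B) = 0] (mod 2))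
    \<and> (\<forall>n::nat. (\<nexists>k::int. int n = 10 * k ^ 2 - 4 * k) \<longrightarrow> [c9 (8 * n + 4) = 0] (mod 2))"
proof (intro conjI)
  show "fps_cong 2 (Abs_fps (\<lambda>n. c9 (8 * n + 4))) (false_theta (- (fps_X ^ 14)) (- (fps_X ^ 6)))"
    using c9_section_cong fps_cong_sym[OF false_theta_14_6_cong] by (rule fps_cong_trans)
next
  have ranges: "{0..<2} = {0, 1 :: int}" "{0..<3} = {0, 1, 2 :: int}"
    "{0..<7} = {0, 1, 2, 3, 4, 5, 6 :: int}"
    by auto
  have "[c9 (16 * n + 12) = 0] (mod 2)" "[c9 (24 * n + 12) = 0] (mod 2)"
    "[c9 (56 * n + 20) = 0] (mod 2)" "[c9 (56 * n + 28) = 0] (mod 2)"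
    "[c9 (56 * n + 44) = 0] (mod 2)" for n
    \<comment> \<open>Here A = 8m and B = 8b + 4. The values of 10r^2 - 4r are 0 modulo 2; 0, 2
      modulo 3; and 0, 1, 4, 6 modulo 7, so each chosen \<open>b\<close> is missed.\<close>
    using c9_even_progression[of 2 1 n] c9_even_progression[of 3 1 n]
      c9_even_progression[of 7 2 n] c9_even_progression[of 7 3 n] c9_even_progression[of 7 5 n]
    by (simp_all add: ranges algebra_simps)
  thus "\<forall>(A, B) \<in> {(16, 12), (24, 12), (56, 20), (56, 28), (56, 44)}.
          \<forall>n::nat. [c9 (A * n + B) = 0] (mod 2)"
    by simp
next
  show "\<forall>n::nat. (\<nexists>k::int. int n = 10 * k ^ 2 - 4 * k) \<longrightarrow> [c9 (8 * n + 4) = 0] (mod 2)"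
    by (intro allI impI c9_even)
qed

end
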